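(* Let $\underline R$ be a square ring. An $\underline R$-BHP-linear map $f:M\to N$ between $\underline R$-BHP-modules $M,N$ induces, in the evident way (on $M/[M,M]_{\underline R}$ by passage to the quotient and on $[M,M]_{\underline R}$ by restriction), a morphism of graded $\mathrm{OP}(\underline R)$-algebras $$\mathrm{Gr}_\gamma(f):\mathrm{Gr}_\gamma(M)\to\mathrm{Gr}_\gamma(N).$$
   Context: A square ring $\underline R=(R_e\xrightarrow{H}R_{ee}\xrightarrow{P}R_e)$ consists of: a set $R_e$ with a group structure $+$ (not necessarily commutative) and an associative unital multiplication satisfying $r(s+t)=rs+rt$ (the law $(r+s)t=rt+st$ is not required); an abelian group $R_{ee}$; a map $R_e\times R_e\times R_{ee}\times R_e\to R_{ee}$, $(r,s,x,t)\mapsto(r,s)\cdot x\cdot t$, additive in each of its four variables and defining commuting actions on $R_{ee}$ of the multiplicative monoids $R_e\times R_e$ (on the left) and $R_e$ (on the right) (write $(r,s)\cdot x$ if $t=1$ and $x\cdot t$ if $r=s=1$); a group homomorphism $T:R_{ee}\to R_{ee}$ with $T^2=\mathrm{Id}$; a map $H:R_e\to R_{ee}$ and a group homomorphism $P:R_{ee}\to R_e$; such that for all $r,s,t\in R_e$, $x,y\in R_{ee}$: $PHP=P+P$; $P((r,r)\cdot x\cdot s)=rP(x)s$; $T=HP-\mathrm{Id}$; $PT=P$; $(P(x),r)\cdot y=(r,P(x))\cdot y=0=y\cdot P(x)$; $H(r+s)=H(r)+H(s)+(s,r)\cdot H(2)$ where $2=1+1$; $H(rs)=(r,r)\cdot H(s)+H(r)\cdot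 s$; $(r+s)t=rt+st+P((r,s)\cdot H(t))$; $T((r,s)\cdot x\cdot t)=(s,r)\cdot T(x)\cdot t$. The quotient $\overline R=R_e/\operatorname{Im}P$ is a ring and $R_{ee}$ is an $\overline R\otimes\overline R\otimes\overline R^{op}$-module. $\mathrm{OP}(\underline R)$ is the operad of abelian groups, nilpotent of class $\le2$, with $\mathrm{OP}(\underline R)_1=\overline R$, $\mathrm{OP}(\underline R)_2=R_{ee}$ (symmetric group action given by $T$), $\mathrm{OP}(\underline R)_k=0$ for $k>2$, and compositions given by the multiplication of $\overline R$ and its actions on $R_{ee}$. Concretely, a graded $\mathrm{OP}(\underline R)$-algebra structure on a graded abelian group $X=(X_1,X_2,0,\ldots)$ consists of right $\overline R$-module structures on $X_1,X_2$ and maps $X_i\times X_j\times R_{ee}\to X_{i+j}$, $(u,v,x)\mapsto[u,v]\cdot x$, additive in each variable, with $[v,u]\cdot x=[u,v]\cdot T(x)$, $([u\cdot r,v\cdot s]\cdot x)\cdot t=[u,v]\cdot((r,s)\cdot x\cdot t)$ for $r,s,t\in\overline R$, and vanishing iterated operations $[[u,v]\cdot x,w]\cdot y=0$; morphisms are degree-preserving additive maps commuting with these operations. A (right) $\underline R$-BHP-module is a group $M$ (written additively, not necessarily commutative) with operations $M\times R_e\to M$, $(m,r)\mapsto m\cdot r$ and $M\times M\times R_{ee}\to M$, $(m,n,x)\mapsto[m,n]\cdot x$ such that: $m\cdot1=m$, $(m\cdot r)\cdot s=m\cdot(rs)$, $m\cdot(r+s)=m\cdot r+m\cdot s$; $(m+n)\cdot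 r=m\cdot r+n\cdot r+[m,n]\cdot H(r)$; $m\cdot P(x)=[m,m]\cdot x$; $[m,n]\cdot T(x)=[n,m]\cdot x$; $[m,n]\cdot x$ is additive in each of $m,n,x$; $([m\cdot r,n\cdot s]\cdot x)\cdot t=[m,n]\cdot((r,s)\cdot x\cdot t)$; $[[m,m']\cdot x,n]\cdot y=0$. $[M,M]_{\underline R}$ is the smallest subgroup of $M$ stable under the operations of $R_e$ and $R_{ee}$ and containing all $[m,n]\cdot x$. A map $f:M\to N$ of BHP-modules is $\underline R$-BHP-linear if it is additive, $f(m\cdot r)=f(m)\cdot r$ and $f([m,m']\cdot x)=[f(m),f(m')]\cdot x$. $\mathrm{Gr}_\gamma(M)=(M/[M,M]_{\underline R},[M,M]_{\underline R},0,\ldots)$ is a graded $\mathrm{OP}(\underline R)$-algebra via $\overline m\cdot\overline r=\overline{m\cdot r}$, $a\cdot\overline r=a\cdot r$ and $\overline m\otimes\overline{m'}\otimes x\mapsto[m,m']\cdot x$ (all other binary operations being zero). *)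

theory Defs
  imports "HOL-Algebra.QuotRing"
begin

text \<open>
  Conventions. A group that carries no ring-like multiplication (\<open>R\<^sub>e\<^sub>e\<close>, modules over a square ring,
  components of graded algebras) is a HOL-Algebra \<^typ>\<open>'a monoid\<close> and is therefore written
  multiplicatively, although the mathematics is written additively: \<open>\<otimes>\<close>, \<open>\<one>\<close>, \<open>inv\<close> below
  stand for \<open>+\<close>, \<open>0\<close>, \<open>-\<close>, also when the group is not commutative.
  \<open>R\<^sub>e\<close> is a \<^typ>\<open>'e ring\<close> record, with \<open>\<oplus>\<close> for its (not necessarily commutative) addition and
  \<open>\<otimes>\<close> for its multiplication.
\<close>

section \<open>Square rings\<close>

text \<open>\<^term>\<open>sq_act R r s x t\<close> is \<open>(r,s) \<cdot> x \<cdot> t\<close>.\<close>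

record ('e, 'x) square_ring_data =
  sq_e :: "'e ring"
  sq_ee :: "'x monoid"
  sq_act :: "'e \<Rightarrow> 'e \<Rightarrow> 'x \<Rightarrow> 'e \<Rightarrow> 'x"
  sq_T :: "'x \<Rightarrow> 'x"
  sq_H :: "'e \<Rightarrow> 'x"
  sq_P :: "'x \<Rightarrow> 'e"

definition sq_lact :: "('e, 'x) square_ring_data \<Rightarrow> 'e \<Rightarrow> 'e \<Rightarrow> 'x \<Rightarrow> 'x"
  where "sq_lact R r s x = sq_act R r s x \<one>\<^bsub>sq_e R\<^esub>"

definition sq_ract :: "('e, 'x) square_ring_data \<Rightarrow> 'x \<Rightarrow> 'e \<Rightarrow> 'x"
  where "sq_ract R x t = sq_act R \<one>\<^bsub>sq_e R\<^esub> \<one>\<^bsub>sq_e R\<^esub> x t"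

definition sq_two :: "('e, 'x) square_ring_data \<Rightarrow> 'e"
  where "sq_two R = \<one>\<^bsub>sq_e R\<^esub> \<oplus>\<^bsub>sq_e R\<^esub> \<one>\<^bsub>sq_e R\<^esub>"

text \<open>\<^term>\<open>monoid E\<close> refers to the multiplication of \<open>E\<close>, \<^term>\<open>group (add_monoid E)\<close> to its addition.\<close>

locale square_ring =
  fixes R :: "('e, 'x) square_ring_data"
    and E :: "'e ring" and Q :: "'x monoid"
  defines "E \<equiv> sq_e R" and "Q \<equiv> sq_ee R"
  assumes add_group: "group (add_monoid E)"
    and mult_monoid: "monoid E"
    and left_distrib: "\<lbrakk>r \<in> carrier E; s \<in> carrier E; t \<in> carrier E\<rbrakk> \<Longrightarrow>
      r \<otimes>\<^bsub>E\<^esub> (s \<oplus>\<^bsub>E\<^esub> t) = r \<otimes>\<^bsub>E\<^esub> s \<oplus>\<^bsub>E\<^esub> r \<otimes>\<^bsub>E\<^esub> t"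
    and ee_group: "comm_group Q"
    and act_closed: "\<lbrakk>r \<in> carrier E; s \<in> carrier E; x \<in> carrier Q; t \<in> carrier E\<rbrakk> \<Longrightarrow>
      sq_act R r s x t \<in> carrier Q"
    and act_add1: "\<lbrakk>r \<in> carrier E; r' \<in> carrier E; s \<in> carrier E; x \<in> carrier Q; t \<in> carrier E\<rbrakk> \<Longrightarrow>
      sq_act R (r \<oplus>\<^bsub>E\<^esub> r') s x t = sq_act R r s x t \<otimes>\<^bsub>Q\<^esub> sq_act R r' s x t"
    and act_add2: "\<lbrakk>r \<in> carrier E; s \<in> carrier E; s' \<in> carrier E; x \<in> carrier Q; t \<in> carrier E\<rbrakk> \<Longrightarrow>
      sq_act R r (s \<oplus>\<^bsub>E\<^esub> s') x t = sq_act R r s x t \<otimes>\<^bsub>Q\<^esub> sq_act R r s' x t"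
    and act_add3: "\<lbrakk>r \<in> carrier E; s \<in> carrier E; x \<in> carrier Q; x' \<in> carrier Q; t \<in> carrier E\<rbrakk> \<Longrightarrow>
      sq_act R r s (x \<otimes>\<^bsub>Q\<^esub> x') t = sq_act R r s x t \<otimes>\<^bsub>Q\<^esub> sq_act R r s x' t"
    and act_add4: "\<lbrakk>r \<in> carrier E; s \<in> carrier E; x \<in> carrier Q; t \<in> carrier E; t' \<in> carrier E\<rbrakk> \<Longrightarrow>
      sq_act R r s x (t \<oplus>\<^bsub>E\<^esub> t') = sq_act R r s x t \<otimes>\<^bsub>Q\<^esub> sq_act R r s x t'"
    and act_one: "x \<in> carrier Q \<Longrightarrow> sq_act R \<one>\<^bsub>E\<^esub> \<one>\<^bsub>E\<^esub> x \<one>\<^bsub>E\<^esub> = x"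
    and lact_lact: "\<lbrakk>r \<in> carrier E; s \<in> carrier E; r' \<in> carrier E; s' \<in> carrier E; x \<in> carrier Q\<rbrakk> \<Longrightarrow>
      sq_lact R r s (sq_lact R r' s' x) = sq_lact R (r \<otimes>\<^bsub>E\<^esub> r') (s \<otimes>\<^bsub>E\<^esub> s') x"
    and ract_ract: "\<lbrakk>x \<in> carrier Q; t \<in> carrier E; t' \<in> carrier E\<rbrakk> \<Longrightarrow>
      sq_ract R (sq_ract R x t) t' = sq_ract R x (t \<otimes>\<^bsub>E\<^esub> t')"
    and act_eq_ract_lact: "\<lbrakk>r \<in> carrier E; s \<in> carrier E; x \<in> carrier Q; t \<in> carrier E\<rbrakk> \<Longrightarrow>
      sq_act R r s x t = sq_ract R (sq_lact R r s x) t"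
    and act_eq_lact_ract: "\<lbrakk>r \<in> carrier E; s \<in> carrier E; x \<in> carrier Q; t \<in> carrier E\<rbrakk> \<Longrightarrow>
      sq_act R r s x t = sq_lact R r s (sq_ract R x t)"
    and T_hom: "sq_T R \<in> hom Q Q"
    and T_T: "x \<in> carrier Q \<Longrightarrow> sq_T R (sq_T R x) = x"
    and H_closed: "r \<in> carrier E \<Longrightarrow> sq_H R r \<in> carrier Q"
    and P_hom: "sq_P R \<in> hom Q (add_monoid E)"
    and P_H_P: "x \<in> carrier Q \<Longrightarrow> sq_P R (sq_H R (sq_P R x)) = sq_P R x \<oplus>\<^bsub>E\<^esub> sq_P R x"
    and P_act: "\<lbrakk>r \<in> carrier E; s \<in> carrier E; x \<in> carrier Q\<rbrakk> \<Longrightarrow>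
      sq_P R (sq_act R r r x s) = r \<otimes>\<^bsub>E\<^esub> sq_P R x \<otimes>\<^bsub>E\<^esub> s"
    and T_eq: "x \<in> carrier Q \<Longrightarrow> sq_T R x = sq_H R (sq_P R x) \<otimes>\<^bsub>Q\<^esub> inv\<^bsub>Q\<^esub> x"
    and P_T: "x \<in> carrier Q \<Longrightarrow> sq_P R (sq_T R x) = sq_P R x"
    and lact_P1: "\<lbrakk>x \<in> carrier Q; y \<in> carrier Q; r \<in> carrier E\<rbrakk> \<Longrightarrow>
      sq_lact R (sq_P R x) r y = \<one>\<^bsub>Q\<^esub>"
    and lact_P2: "\<lbrakk>x \<in> carrier Q; y \<in> carrier Q; r \<in> carrier E\<rbrakk> \<Longrightarrow>
      sq_lact R r (sq_P R x) y = \<one>\<^bsub>Q\<^esub>"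
    and ract_P: "\<lbrakk>x \<in> carrier Q; y \<in> carrier Q\<rbrakk> \<Longrightarrow> sq_ract R y (sq_P R x) = \<one>\<^bsub>Q\<^esub>"
    and H_add: "\<lbrakk>r \<in> carrier E; s \<in> carrier E\<rbrakk> \<Longrightarrow>
      sq_H R (r \<oplus>\<^bsub>E\<^esub> s) = sq_H R r \<otimes>\<^bsub>Q\<^esub> sq_H R s \<otimes>\<^bsub>Q\<^esub> sq_lact R s r (sq_H R (sq_two R))"
    and H_mult: "\<lbrakk>r \<in> carrier E; s \<in> carrier E\<rbrakk> \<Longrightarrow>
      sq_H R (r \<otimes>\<^bsub>E\<^esub> s) = sq_lact R r r (sq_H R s) \<otimes>\<^bsub>Q\<^esub> sq_ract R (sq_H R r) s"
    and right_distrib: "\<lbrakk>r \<in> carrier E; s \<in> carrier E; t \<in> carrier E\<rbrakk> \<Longrightarrow>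
      (r \<oplus>\<^bsub>E\<^esub> s) \<otimes>\<^bsub>E\<^esub> t =
        r \<otimes>\<^bsub>E\<^esub> t \<oplus>\<^bsub>E\<^esub> s \<otimes>\<^bsub>E\<^esub> t \<oplus>\<^bsub>E\<^esub> sq_P R (sq_lact R r s (sq_H R t))"
    and T_act: "\<lbrakk>r \<in> carrier E; s \<in> carrier E; x \<in> carrier Q; t \<in> carrier E\<rbrakk> \<Longrightarrow>
      sq_T R (sq_act R r s x t) = sq_act R s r (sq_T R x) t"

text \<open>\<open>\<Rbar> = R\<^sub>e / Im P\<close>: the construction \<^const>\<open>FactRing\<close> is meaningful although \<open>R\<^sub>e\<close> is only a
  near-ring, and for a square ring the quotient is a ring.\<close>

definition sq_bar :: "('e, 'x) square_ring_data \<Rightarrow> 'e set ring"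
  where "sq_bar R = sq_e R Quot (sq_P R ` carrier (sq_ee R))"

text \<open>Operations on cosets are \<^const>\<open>the_elem\<close> of the set of all values on representatives; that this
  set is a singleton is the well-definedness of the induced operation.\<close>

definition sq_act_bar ::
    "('e, 'x) square_ring_data \<Rightarrow> 'e set \<Rightarrow> 'e set \<Rightarrow> 'x \<Rightarrow> 'e set \<Rightarrow> 'x"
  where "sq_act_bar R A B x C = the_elem {sq_act R r s x t | r s t. r \<in> A \<and> s \<in> B \<and> t \<in> C}"

section \<open>Graded algebras over the operad of a square ring\<close>

locale right_module =
  fixes S :: "'r ring" and X :: "'a monoid" and act :: "'a \<Rightarrow> 'r \<Rightarrow> 'a"
  assumes scalar_ring: "ring S"
    and group: "comm_group X"
    and closed: "\<lbrakk>a \<in> carrier X; r \<in> carrier S\<rbrakk> \<Longrightarrow> act a r \<in> carrier X"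
    and add_left: "\<lbrakk>a \<in> carrier X; b \<in> carrier X; r \<in> carrier S\<rbrakk> \<Longrightarrow>
      act (a \<otimes>\<^bsub>X\<^esub> b) r = act a r \<otimes>\<^bsub>X\<^esub> act b r"
    and add_right: "\<lbrakk>a \<in> carrier X; r \<in> carrier S; s \<in> carrier S\<rbrakk> \<Longrightarrow>
      act a (r \<oplus>\<^bsub>S\<^esub> s) = act a r \<otimes>\<^bsub>X\<^esub> act a s"
    and assoc: "\<lbrakk>a \<in> carrier X; r \<in> carrier S; s \<in> carrier S\<rbrakk> \<Longrightarrow>
      act (act a r) s = act a (r \<otimes>\<^bsub>S\<^esub> s)"
    and unit: "a \<in> carrier X \<Longrightarrow> act a \<one>\<^bsub>S\<^esub> = a"

text \<open>
  A graded abelian group \<open>(X\<^sub>1, X\<^sub>2, 0, \<dots>)\<close> is recorded by its two possibly non-zero components.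
  Hence the only binary operation with possibly non-zero target is \<open>X\<^sub>1 \<times> X\<^sub>1 \<times> R\<^sub>e\<^sub>e \<rightarrow> X\<^sub>2\<close>,
  where \<^term>\<open>op_br X u v x\<close> is \<open>[u,v] \<cdot> x\<close>. All other binary operations, and all iterated ones,
  take values in components \<open>X\<^sub>k = 0\<close> with \<open>k > 2\<close>; they are zero, the laws for them hold trivially,
  and so neither appears.
\<close>

record ('a, 'b, 'e, 'x) op_data =
  op_1 :: "'a monoid"
  op_2 :: "'b monoid"
  op_act1 :: "'a \<Rightarrow> 'e set \<Rightarrow> 'a"
  op_act2 :: "'b \<Rightarrow> 'e set \<Rightarrow> 'b"
  op_br :: "'a \<Rightarrow> 'a \<Rightarrow> 'x \<Rightarrow> 'b"

locale op_algebra =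
  fixes R :: "('e, 'x) square_ring_data" and X :: "('a, 'b, 'e, 'x) op_data"
  assumes square_ring: "square_ring R"
    and module1: "right_module (sq_bar R) (op_1 X) (op_act1 X)"
    and module2: "right_module (sq_bar R) (op_2 X) (op_act2 X)"
    and br_closed: "\<lbrakk>u \<in> carrier (op_1 X); v \<in> carrier (op_1 X); x \<in> carrier (sq_ee R)\<rbrakk> \<Longrightarrow>
      op_br X u v x \<in> carrier (op_2 X)"
    and br_add1: "\<lbrakk>u \<in> carrier (op_1 X); u' \<in> carrier (op_1 X); v \<in> carrier (op_1 X);
        x \<in> carrier (sq_ee R)\<rbrakk> \<Longrightarrow>
      op_br X (u \<otimes>\<^bsub>op_1 X\<^esub> u') v x = op_br X u v x \<otimes>\<^bsub>op_2 X\<^esub> op_br X u' v x"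
    and br_add2: "\<lbrakk>u \<in> carrier (op_1 X); v \<in> carrier (op_1 X); v' \<in> carrier (op_1 X);
        x \<in> carrier (sq_ee R)\<rbrakk> \<Longrightarrow>
      op_br X u (v \<otimes>\<^bsub>op_1 X\<^esub> v') x = op_br X u v x \<otimes>\<^bsub>op_2 X\<^esub> op_br X u v' x"
    and br_add3: "\<lbrakk>u \<in> carrier (op_1 X); v \<in> carrier (op_1 X); x \<in> carrier (sq_ee R);
        x' \<in> carrier (sq_ee R)\<rbrakk> \<Longrightarrow>
      op_br X u v (x \<otimes>\<^bsub>sq_ee R\<^esub> x') = op_br X u v x \<otimes>\<^bsub>op_2 X\<^esub> op_br X u v x'"
    and br_sym: "\<lbrakk>u \<in> carrier (op_1 X); v \<in> carrier (op_1 X); x \<in> carrier (sq_ee R)\<rbrakk> \<Longrightarrow>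
      op_br X v u x = op_br X u v (sq_T R x)"
    and br_act: "\<lbrakk>u \<in> carrier (op_1 X); v \<in> carrier (op_1 X); x \<in> carrier (sq_ee R);
        r \<in> carrier (sq_bar R); s \<in> carrier (sq_bar R); t \<in> carrier (sq_bar R)\<rbrakk> \<Longrightarrow>
      op_act2 X (op_br X (op_act1 X u r) (op_act1 X v s) x) t = op_br X u v (sq_act_bar R r s x t)"

text \<open>A degree-preserving map is the pair of its components in degrees 1 and 2.\<close>

locale op_algebra_hom =
  source: op_algebra R X + target: op_algebra R Y
  for R :: "('e, 'x) square_ring_data"
    and X :: "('a, 'b, 'e, 'x) op_data" and Y :: "('c, 'd, 'e, 'x) op_data" +
  fixes \<phi> :: "('a \<Rightarrow> 'c) \<times> ('b \<Rightarrow> 'd)"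
  assumes hom1: "fst \<phi> \<in> hom (op_1 X) (op_1 Y)"
    and hom2: "snd \<phi> \<in> hom (op_2 X) (op_2 Y)"
    and hom_act1: "\<lbrakk>u \<in> carrier (op_1 X); r \<in> carrier (sq_bar R)\<rbrakk> \<Longrightarrow>
      fst \<phi> (op_act1 X u r) = op_act1 Y (fst \<phi> u) r"
    and hom_act2: "\<lbrakk>a \<in> carrier (op_2 X); r \<in> carrier (sq_bar R)\<rbrakk> \<Longrightarrow>
      snd \<phi> (op_act2 X a r) = op_act2 Y (snd \<phi> a) r"
    and hom_br: "\<lbrakk>u \<in> carrier (op_1 X); v \<in> carrier (op_1 X); x \<in> carrier (sq_ee R)\<rbrakk> \<Longrightarrow>
      snd \<phi> (op_br X u v x) = op_br Y (fst \<phi> u) (fst \<phi> v) x"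

section \<open>BHP-modules\<close>

text \<open>\<^term>\<open>bhp_act M m r\<close> is \<open>m \<cdot> r\<close>, and \<^term>\<open>bhp_br M m n x\<close> is \<open>[m,n] \<cdot> x\<close>.\<close>

record ('m, 'e, 'x) bhp_data = "'m monoid" +
  bhp_act :: "'m \<Rightarrow> 'e \<Rightarrow> 'm"
  bhp_br :: "'m \<Rightarrow> 'm \<Rightarrow> 'x \<Rightarrow> 'm"

locale bhp_module =
  square_ring R E Q + M: group M
  for R :: "('e, 'x) square_ring_data" and E and Q
    and M :: "('m, 'e, 'x) bhp_data" (structure) +
  assumes bhp_act_closed: "\<lbrakk>m \<in> carrier M; r \<in> carrier E\<rbrakk> \<Longrightarrow> bhp_act M m r \<in> carrier M"
    and bhp_br_closed: "\<lbrakk>m \<in> carrier M; n \<in> carrier M; x \<in> carrier Q\<rbrakk> \<Longrightarrow>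
      bhp_br M m n x \<in> carrier M"
    and bhp_act_one: "m \<in> carrier M \<Longrightarrow> bhp_act M m \<one>\<^bsub>E\<^esub> = m"
    and bhp_act_act: "\<lbrakk>m \<in> carrier M; r \<in> carrier E; s \<in> carrier E\<rbrakk> \<Longrightarrow>
      bhp_act M (bhp_act M m r) s = bhp_act M m (r \<otimes>\<^bsub>E\<^esub> s)"
    and bhp_act_add: "\<lbrakk>m \<in> carrier M; r \<in> carrier E; s \<in> carrier E\<rbrakk> \<Longrightarrow>
      bhp_act M m (r \<oplus>\<^bsub>E\<^esub> s) = bhp_act M m r \<otimes> bhp_act M m s"
    and bhp_add_act: "\<lbrakk>m \<in> carrier M; n \<in> carrier M; r \<in> carrier E\<rbrakk> \<Longrightarrow>
      bhp_act M (m \<otimes> n) r = bhp_act M m r \<otimes> bhp_act M n r \<otimes> bhp_br M m n (sq_H R r)"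
    and bhp_act_P: "\<lbrakk>m \<in> carrier M; x \<in> carrier Q\<rbrakk> \<Longrightarrow> bhp_act M m (sq_P R x) = bhp_br M m m x"
    and bhp_br_T: "\<lbrakk>m \<in> carrier M; n \<in> carrier M; x \<in> carrier Q\<rbrakk> \<Longrightarrow>
      bhp_br M m n (sq_T R x) = bhp_br M n m x"
    and bhp_br_add1: "\<lbrakk>m \<in> carrier M; m' \<in> carrier M; n \<in> carrier M; x \<in> carrier Q\<rbrakk> \<Longrightarrow>
      bhp_br M (m \<otimes> m') n x = bhp_br M m n x \<otimes> bhp_br M m' n x"
    and bhp_br_add2: "\<lbrakk>m \<in> carrier M; n \<in> carrier M; n' \<in> carrier M; x \<in> carrier Q\<rbrakk> \<Longrightarrow>
      bhp_br M m (n \<otimes> n') x = bhp_br M m n x \<otimes> bhp_br M m n' x"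
    and bhp_br_add3: "\<lbrakk>m \<in> carrier M; n \<in> carrier M; x \<in> carrier Q; x' \<in> carrier Q\<rbrakk> \<Longrightarrow>
      bhp_br M m n (x \<otimes>\<^bsub>Q\<^esub> x') = bhp_br M m n x \<otimes> bhp_br M m n x'"
    and bhp_br_act: "\<lbrakk>m \<in> carrier M; n \<in> carrier M; r \<in> carrier E; s \<in> carrier E;
        x \<in> carrier Q; t \<in> carrier E\<rbrakk> \<Longrightarrow>
      bhp_act M (bhp_br M (bhp_act M m r) (bhp_act M n s) x) t = bhp_br M m n (sq_act R r s x t)"
    and bhp_br_br: "\<lbrakk>m \<in> carrier M; m' \<in> carrier M; n \<in> carrier M; x \<in> carrier Q; y \<in> carrier Q\<rbrakk> \<Longrightarrow>
      bhp_br M (bhp_br M m m' x) n y = \<one>"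

definition bhp_linear ::
    "('e, 'x) square_ring_data \<Rightarrow> ('m, 'e, 'x) bhp_data \<Rightarrow> ('n, 'e, 'x) bhp_data \<Rightarrow> ('m \<Rightarrow> 'n) \<Rightarrow> bool"
  where "bhp_linear R M N f \<longleftrightarrow>
    f \<in> hom M N \<and>
    (\<forall>m \<in> carrier M. \<forall>r \<in> carrier (sq_e R). f (bhp_act M m r) = bhp_act N (f m) r) \<and>
    (\<forall>m \<in> carrier M. \<forall>m' \<in> carrier M. \<forall>x \<in> carrier (sq_ee R).
      f (bhp_br M m m' x) = bhp_br N (f m) (f m') x)"

definition bhp_stable :: "('e, 'x) square_ring_data \<Rightarrow> ('m, 'e, 'x) bhp_data \<Rightarrow> 'm set \<Rightarrow> bool"
  where "bhp_stable R M K \<longleftrightarrow>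
    (\<forall>m \<in> K. \<forall>r \<in> carrier (sq_e R). bhp_act M m r \<in> K) \<and>
    (\<forall>m \<in> K. \<forall>n \<in> K. \<forall>x \<in> carrier (sq_ee R). bhp_br M m n x \<in> K)"

text \<open>\<open>[M,M]\<^sub>R\<close>. For a BHP-module the family contains \<^term>\<open>carrier M\<close> and is closed under
  intersection, so this is its smallest member.\<close>

definition bhp_commutator :: "('e, 'x) square_ring_data \<Rightarrow> ('m, 'e, 'x) bhp_data \<Rightarrow> 'm set"
  where "bhp_commutator R M = \<Inter> {K. subgroup K M \<and> bhp_stable R M K \<and>
    (\<forall>m \<in> carrier M. \<forall>n \<in> carrier M. \<forall>x \<in> carrier (sq_ee R). bhp_br M m n x \<in> K)}"

section \<open>The associated graded algebra\<close>

definition Gr_gamma ::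
    "('e, 'x) square_ring_data \<Rightarrow> ('m, 'e, 'x) bhp_data \<Rightarrow> ('m set, 'm, 'e, 'x) op_data"
  where "Gr_gamma R M = (let K = bhp_commutator R M in
    \<lparr>op_1 = M Mod K,
     op_2 = \<lparr>carrier = K, monoid.mult = (\<otimes>\<^bsub>M\<^esub>), one = \<one>\<^bsub>M\<^esub>\<rparr>,
     op_act1 = (\<lambda>C A. the_elem {K #>\<^bsub>M\<^esub> bhp_act M m r | m r. m \<in> C \<and> r \<in> A}),
     op_act2 = (\<lambda>a A. the_elem {bhp_act M a r | r. r \<in> A}),
     op_br = (\<lambda>C D x. the_elem {bhp_br M m n x | m n. m \<in> C \<and> n \<in> D})\<rparr>)"

definition Gr_gamma_map ::
    "('e, 'x) square_ring_data \<Rightarrow> ('m, 'e, 'x) bhp_data \<Rightarrow> ('n, 'e, 'x) bhp_data \<Rightarrow>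
      ('m \<Rightarrow> 'n) \<Rightarrow> ('m set \<Rightarrow> 'n set) \<times> ('m \<Rightarrow> 'n)"
  where "Gr_gamma_map R M N f =
    (\<lambda>C. the_elem {bhp_commutator R N #>\<^bsub>N\<^esub> f m | m. m \<in> C},
     restrict f (bhp_commutator R M))"

end

theory Submission
  imports Defs
begin

text \<open>
  Expanding \<open>(r + s) \<cdot> 2\<close> in \<open>R\<^sub>e\<close> in two ways gives \<open>s + r = r + s + P((r,s) \<cdot> H(2))\<close>; in particular
  \<open>Im P\<close> is central and the quotient is abelian. The same computation in a BHP-module \<open>M\<close> yields
  \<open>n + m = m + n + [m,n] \<cdot> H(2)\<close>. The elements \<open>k\<close> with \<open>[k,n] \<cdot> x = 0\<close> for all \<open>n\<close> and \<open>x\<close> form a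
  subgroup stable under \<open>R\<^sub>e\<close> that contains all brackets, hence contains \<open>[M,M]\<^sub>R\<close>. So \<open>[M,M]\<^sub>R\<close> is
  central, brackets only depend on classes modulo \<open>[M,M]\<^sub>R\<close>, and since \<open>m \<cdot> P(x) = [m,m] \<cdot> x\<close> the
  operators in \<open>Im P\<close> vanish on both graded pieces. Finally \<open>f\<close> maps \<open>[M,M]\<^sub>R\<close> to \<open>[N,N]\<^sub>R\<close> because
  the preimage of the latter is one of the subgroups over which \<open>[M,M]\<^sub>R\<close> is the intersection.
\<close>

section \<open>Values on cosets, and quotients by central subgroups\<close>

lemma the_elem_eqI: "x \<in> S \<Longrightarrow> (\<And>y. y \<in> S \<Longrightarrow> y = x) \<Longrightarrow> the_elem S = x"
  by (metis is_singletonI' is_singleton_the_elem singletonD empty_iff)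

lemma (in group) central_subgroup_normal:
  assumes "subgroup H G"
    and "\<And>h x. h \<in> H \<Longrightarrow> x \<in> carrier G \<Longrightarrow> x \<otimes> h = h \<otimes> x"
  shows "H \<lhd> G"
proof -
  have "x \<otimes> h \<otimes> inv x \<in> H" if "x \<in> carrier G" "h \<in> H" for x h
    using that assms subgroup.mem_carrier[OF assms(1)] by (simp add: m_assoc)
  then show ?thesis
    using assms(1) by (simp add: normal_inv_iff)
qed

lemma (in group) r_coset_absorb:
  assumes "subgroup H G" "h \<in> H" "x \<in> carrier G"
  shows "H #> (h \<otimes> x) = H #> x"
  using assms by (metis coset_join2 coset_mult_assoc subgroup.mem_carrier subgroup.subset)

text \<open>The factor \<open>h\<close> stands on the left, where \<open>r_coset_absorb\<close>
  removes it. Serves both for \<open>R_e\<close> modulo the image of \<open>P\<close> and for a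
  module modulo \<open>[M,M]\<close>.\<close>

lemma (in normal) comm_group_FactGroup:
  assumes "\<And>x y. x \<in> carrier G \<Longrightarrow> y \<in> carrier G \<Longrightarrow> \<exists>h\<in>H. y \<otimes> x = h \<otimes> (x \<otimes> y)"
  shows "comm_group (G Mod H)"
proof (rule group.group_comm_groupI[OF factorgroup_is_group])
  fix A B
  assume "A \<in> carrier (G Mod H)" "B \<in> carrier (G Mod H)"
  then obtain x y where "x \<in> carrier G" "y \<in> carrier G" "A = H #> x" "B = H #> y"
    by (auto simp: FactGroup_def RCOSETS_def)
  moreover obtain h where "h \<in> H" "y \<otimes> x = h \<otimes> (x \<otimes> y)"
    using assms calculation by blast
  ultimately show "A \<otimes>\<^bsub>G Mod H\<^esub> B = B \<otimes>\<^bsub>G Mod H\<^esub> A"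
    by (simp add: FactGroup_def rcos_sum r_coset_absorb is_subgroup)
qed

section \<open>The quotient ring\<close>

text \<open>Addition in \<open>E\<close> need not commute, so general group theory is imported and
  rewritten to the operations of \<open>E\<close>.\<close>

sublocale square_ring \<subseteq> add: group "add_monoid E"
  rewrites "carrier (add_monoid E) = carrier E"
    and "monoid.mult (add_monoid E) = add E"
    and "one (add_monoid E) = zero E"
  by (rule add_group) simp_all

sublocale square_ring \<subseteq> mult: monoid E
  by (rule mult_monoid)

sublocale square_ring \<subseteq> ee: comm_group Q
  by (rule ee_group)

context square_ring
begin

section \<open>Addition of \<open>R_e\<close> modulo the image of \<open>P\<close>\<close>

abbreviation im_P :: "'e set"
  where "im_P \<equiv> sq_P R ` carrier Q"

lemma sq_two_closed: "sq_two R \<in> carrier E"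
  unfolding sq_two_def by (fold E_def) simp

lemma lact_closed: "\<lbrakk>r \<in> carrier E; s \<in> carrier E; x \<in> carrier Q\<rbrakk> \<Longrightarrow> sq_lact R r s x \<in> carrier Q"
  unfolding sq_lact_def by (fold E_def) (simp add: act_closed)

lemma P_closed [simp]: "x \<in> carrier Q \<Longrightarrow> sq_P R x \<in> carrier E"
  using P_hom by (auto simp: hom_def)

lemma P_mult: "\<lbrakk>x \<in> carrier Q; y \<in> carrier Q\<rbrakk> \<Longrightarrow> sq_P R (x \<otimes>\<^bsub>Q\<^esub> y) = sq_P R x \<oplus>\<^bsub>E\<^esub> sq_P R y"
  using P_hom by (auto simp: hom_def)

lemma P_one [simp]: "sq_P R \<one>\<^bsub>Q\<^esub> = \<zero>\<^bsub>E\<^esub>"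
  using P_mult[of "\<one>\<^bsub>Q\<^esub>" "\<one>\<^bsub>Q\<^esub>"] by simp

text \<open>Left and right distributivity both expand (r + s)2, and the leading r is cancelled. The
  trailing s has to stay: the \<open>P\<close> term to its right is not yet known to be
  central.\<close>

lemma add_swap:
  assumes "r \<in> carrier E" "s \<in> carrier E"
  shows "s \<oplus>\<^bsub>E\<^esub> r \<oplus>\<^bsub>E\<^esub> s =
    r \<oplus>\<^bsub>E\<^esub> s \<oplus>\<^bsub>E\<^esub> s \<oplus>\<^bsub>E\<^esub> sq_P R (sq_lact R r s (sq_H R (sq_two R)))" (is "_ = _ \<oplus>\<^bsub>E\<^esub> ?p")
proof -
  have p: "?p \<in> carrier E"
    using assms by (simp add: lact_closed H_closed sq_two_closed)
  have two: "t \<otimes>\<^bsub>E\<^esub> sq_two R = t \<oplus>\<^bsub>E\<^esub> t" if "t \<in> carrier E" for t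
    unfolding sq_two_def using that by (fold E_def) (simp add: left_distrib)
  have "(r \<oplus>\<^bsub>E\<^esub> s) \<oplus>\<^bsub>E\<^esub> (r \<oplus>\<^bsub>E\<^esub> s) = (r \<oplus>\<^bsub>E\<^esub> r) \<oplus>\<^bsub>E\<^esub> (s \<oplus>\<^bsub>E\<^esub> s) \<oplus>\<^bsub>E\<^esub> ?p"
    using assms right_distrib[OF assms sq_two_closed] by (simp add: two)
  then have "r \<oplus>\<^bsub>E\<^esub> (s \<oplus>\<^bsub>E\<^esub> r \<oplus>\<^bsub>E\<^esub> s) = r \<oplus>\<^bsub>E\<^esub> (r \<oplus>\<^bsub>E\<^esub> s \<oplus>\<^bsub>E\<^esub> s \<oplus>\<^bsub>E\<^esub> ?p)"
    using assms p by (simp add: add.m_assoc)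
  then show ?thesis
    using assms p add.Units_l_cancel[of r "s \<oplus>\<^bsub>E\<^esub> r \<oplus>\<^bsub>E\<^esub> s" "r \<oplus>\<^bsub>E\<^esub> s \<oplus>\<^bsub>E\<^esub> s \<oplus>\<^bsub>E\<^esub> ?p"]
    by (simp only: add.m_closed add.Units_eq)
qed

text \<open>In \<open>add_swap\<close> with r in the image of \<open>P\<close> the correction
  vanishes by \<open>lact_P1\<close>, which frees the trailing s for cancellation.\<close>

lemma P_central:
  assumes "x \<in> carrier Q" "s \<in> carrier E"
  shows "s \<oplus>\<^bsub>E\<^esub> sq_P R x = sq_P R x \<oplus>\<^bsub>E\<^esub> s"
proof -
  have "s \<oplus>\<^bsub>E\<^esub> sq_P R x \<oplus>\<^bsub>E\<^esub> s = sq_P R x \<oplus>\<^bsub>E\<^esub> s \<oplus>\<^bsub>E\<^esub> s"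
    using add_swap[of "sq_P R x" s] assms by (simp add: lact_P1 H_closed sq_two_closed)
  then show ?thesis
    using assms by simp
qed

text \<open>The correction of \<open>add_swap\<close>, now central, moves to the front, and the
  trailing s cancels.\<close>

lemma add_commute_mod_P:
  assumes "r \<in> carrier E" "s \<in> carrier E"
  shows "\<exists>p\<in>im_P. s \<oplus>\<^bsub>E\<^esub> r = p \<oplus>\<^bsub>E\<^esub> (r \<oplus>\<^bsub>E\<^esub> s)"
proof -
  define x where "x = sq_lact R r s (sq_H R (sq_two R))"
  have x: "x \<in> carrier Q"
    using assms by (simp add: x_def lact_closed H_closed sq_two_closed)
  have "s \<oplus>\<^bsub>E\<^esub> r \<oplus>\<^bsub>E\<^esub> s = sq_P R x \<oplus>\<^bsub>E\<^esub> (r \<oplus>\<^bsub>E\<^esub> s) \<oplus>\<^bsub>E\<^esub> s"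
    using add_swap[OF assms] P_central[OF x, of "r \<oplus>\<^bsub>E\<^esub> s \<oplus>\<^bsub>E\<^esub> s"] assms x
    by (simp add: add.m_assoc flip: x_def)
  then show ?thesis
    using assms x by auto
qed

lemma im_P_subgroup: "subgroup im_P (add_monoid E)"
  using group_hom.img_is_subgroup[of Q "add_monoid E" "sq_P R"] P_hom add_group ee.is_group
  by (simp add: group_hom_def group_hom_axioms_def)

lemma im_P_normal: "im_P \<lhd> add_monoid E"
  by (rule group.central_subgroup_normal[OF add_group im_P_subgroup]) (auto simp: P_central)

section \<open>The ring structure on classes modulo the image of \<open>P\<close>\<close>

abbreviation cls :: "'e \<Rightarrow> 'e set"
  where "cls r \<equiv> im_P +>\<^bsub>E\<^esub> r"

lemma mem_cls_iff: "r' \<in> cls r \<longleftrightarrow> (\<exists>x\<in>carrier Q. r' = sq_P R x \<oplus>\<^bsub>E\<^esub> r)"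
  by (auto simp: a_r_coset_def r_coset_def)

lemma cls_self: "r \<in> carrier E \<Longrightarrow> r \<in> cls r"
  unfolding mem_cls_iff by (rule bexI[of _ "\<one>\<^bsub>Q\<^esub>"]) auto

lemma cls_P: "\<lbrakk>x \<in> carrier Q; r \<in> carrier E\<rbrakk> \<Longrightarrow> cls (sq_P R x \<oplus>\<^bsub>E\<^esub> r) = cls r"
  using group.r_coset_absorb[OF add_group im_P_subgroup, of "sq_P R x" r]
  by (simp add: a_r_coset_def)

lemma cls_P': "\<lbrakk>x \<in> carrier Q; r \<in> carrier E\<rbrakk> \<Longrightarrow> cls (r \<oplus>\<^bsub>E\<^esub> sq_P R x) = cls r"
  by (simp add: P_central cls_P)

lemma sq_bar_eq: "sq_bar R = E Quot im_P"
  by (simp add: sq_bar_def E_def Q_def)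

lemma carrier_sq_bar: "carrier (sq_bar R) = cls ` carrier E"
  unfolding sq_bar_eq by (auto simp: FactRing_def A_RCOSETS_def RCOSETS_def a_r_coset_def)

lemma one_sq_bar: "\<one>\<^bsub>sq_bar R\<^esub> = cls \<one>\<^bsub>E\<^esub>"
  unfolding sq_bar_eq by (simp add: FactRing_def)

text \<open>Lets \<open>comm_group_FactGroup\<close> supply commutative addition in
  \<open>sq_bar_ring\<close>.\<close>

lemma add_monoid_sq_bar: "add_monoid (sq_bar R) = add_monoid E Mod im_P"
  unfolding sq_bar_eq
  by (simp add: FactRing_def FactGroup_def A_RCOSETS_def set_add_def[abs_def])

lemma add_sq_bar:
  assumes "r \<in> carrier E" "s \<in> carrier E"
  shows "cls r \<oplus>\<^bsub>sq_bar R\<^esub> cls s = cls (r \<oplus>\<^bsub>E\<^esub> s)"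
  using normal.rcos_sum[OF im_P_normal, of r s] assms
  by (simp add: sq_bar_eq FactRing_def set_add_def a_r_coset_def)

text \<open>By \<open>P_act\<close>, a product with one factor in the image of \<open>P\<close> lies
  again in that image. Splitting the left factor creates a right distributivity defect, which
  \<open>lact_P1\<close> kills.\<close>

lemma cls_mult:
  assumes "r \<in> carrier E" "s \<in> carrier E" "r' \<in> cls r" "s' \<in> cls s"
  shows "cls (r' \<otimes>\<^bsub>E\<^esub> s') = cls (r \<otimes>\<^bsub>E\<^esub> s)"
proof -
  obtain x y where xy: "x \<in> carrier Q" "y \<in> carrier Q"
    and r': "r' = sq_P R x \<oplus>\<^bsub>E\<^esub> r" and s': "s' = sq_P R y \<oplus>\<^bsub>E\<^esub> s"
    using assms by (auto simp: mem_cls_iff)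
  have r'c: "r' \<in> carrier E"
    using xy assms(1) r' by simp
  define y' where "y' = sq_act R r' r' y \<one>\<^bsub>E\<^esub>"
  define x' where "x' = sq_act R \<one>\<^bsub>E\<^esub> \<one>\<^bsub>E\<^esub> x s"
  have xy': "x' \<in> carrier Q" "y' \<in> carrier Q"
    using xy assms r'c by (simp_all add: x'_def y'_def act_closed)
  have "r' \<otimes>\<^bsub>E\<^esub> s' = r' \<otimes>\<^bsub>E\<^esub> sq_P R y \<oplus>\<^bsub>E\<^esub> r' \<otimes>\<^bsub>E\<^esub> s"
    using xy assms r'c by (simp add: s' left_distrib)
  also have "r' \<otimes>\<^bsub>E\<^esub> sq_P R y = sq_P R y'"
    unfolding y'_def using P_act[of r' "\<one>\<^bsub>E\<^esub>" y] xy r'c by simp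
  also have "r' \<otimes>\<^bsub>E\<^esub> s = sq_P R x \<otimes>\<^bsub>E\<^esub> s \<oplus>\<^bsub>E\<^esub> r \<otimes>\<^bsub>E\<^esub> s"
    unfolding r' using xy assms by (simp add: right_distrib lact_P1 H_closed)
  also have "sq_P R x \<otimes>\<^bsub>E\<^esub> s = sq_P R x'"
    unfolding x'_def using P_act[of "\<one>\<^bsub>E\<^esub>" s x] xy assms by simp
  finally show ?thesis
    using assms xy' by (simp add: cls_P)
qed

text \<open>\<open>FactRing\<close> multiplies by uniting the cosets of all products of
  representatives. These cosets coincide by \<open>cls_mult\<close>, and the union is over nonempty
  classes.\<close>

lemma mult_sq_bar:
  assumes "r \<in> carrier E" "s \<in> carrier E"
  shows "cls r \<otimes>\<^bsub>sq_bar R\<^esub> cls s = cls (r \<otimes>\<^bsub>E\<^esub> s)"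
proof -
  have "cls r \<otimes>\<^bsub>sq_bar R\<^esub> cls s = (\<Union>a\<in>cls r. \<Union>b\<in>cls s. cls (a \<otimes>\<^bsub>E\<^esub> b))"
    by (simp add: sq_bar_eq FactRing_def rcoset_mult_def)
  also have "\<dots> = (\<Union>a\<in>cls r. \<Union>b\<in>cls s. cls (r \<otimes>\<^bsub>E\<^esub> s))"
    using assms by (simp add: cls_mult)
  also have "\<dots> = cls (r \<otimes>\<^bsub>E\<^esub> s)"
    using cls_self[OF assms(1)] cls_self[OF assms(2)] by blast
  finally show ?thesis .
qed

lemmas sq_bar_simps = carrier_sq_bar one_sq_bar add_sq_bar mult_sq_bar

lemma sq_bar_ring: "ring (sq_bar R)"
proof (rule ringI)
  have "comm_group (add_monoid (sq_bar R))"
    unfolding add_monoid_sq_bar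
    by (rule normal.comm_group_FactGroup[OF im_P_normal]) (use add_commute_mod_P in simp)
  then show "abelian_group (sq_bar R)"
    by (simp add: abelian_group_def abelian_group_axioms_def abelian_monoid_def comm_group_def)
  show "monoid (sq_bar R)"
    by (rule monoidI) (auto simp: sq_bar_simps mult.m_assoc)
  fix A B C
  assume "A \<in> carrier (sq_bar R)" "B \<in> carrier (sq_bar R)" "C \<in> carrier (sq_bar R)"
  then obtain r s t where ABC: "A = cls r" "B = cls s" "C = cls t"
    and rst: "r \<in> carrier E" "s \<in> carrier E" "t \<in> carrier E"
    by (auto simp: carrier_sq_bar)
  \<comment> \<open>The defect of right distributivity in \<open>R_e\<close> is a value of
    \<open>P\<close>, so \<open>cls_P'\<close> absorbs it.\<close>
  show "(A \<oplus>\<^bsub>sq_bar R\<^esub> B) \<otimes>\<^bsub>sq_bar R\<^esub> C = A \<otimes>\<^bsub>sq_bar R\<^esub> C \<oplus>\<^bsub>sq_bar R\<^esub> B \<otimes>\<^bsub>sq_bar R\<^esub> C"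
    using rst by (simp add: ABC sq_bar_simps right_distrib cls_P' lact_closed H_closed)
  show "C \<otimes>\<^bsub>sq_bar R\<^esub> (A \<oplus>\<^bsub>sq_bar R\<^esub> B) = C \<otimes>\<^bsub>sq_bar R\<^esub> A \<oplus>\<^bsub>sq_bar R\<^esub> C \<otimes>\<^bsub>sq_bar R\<^esub> B"
    using rst by (simp add: ABC sq_bar_simps left_distrib)
qed

text \<open>The action splits into a left and a right part in either order; the part containing the
  value of \<open>P\<close> is taken outermost, where an axiom kills it.\<close>

lemma act_P:
  assumes "r \<in> carrier E" "s \<in> carrier E" "x \<in> carrier Q" "t \<in> carrier E" "y \<in> carrier Q"
  shows "sq_act R (sq_P R y) s x t = \<one>\<^bsub>Q\<^esub>"
    and "sq_act R r (sq_P R y) x t = \<one>\<^bsub>Q\<^esub>"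
    and "sq_act R r s x (sq_P R y) = \<one>\<^bsub>Q\<^esub>"
proof -
  have ract: "sq_ract R x t \<in> carrier Q"
    unfolding sq_ract_def using assms by (fold E_def) (simp add: act_closed)
  show "sq_act R (sq_P R y) s x t = \<one>\<^bsub>Q\<^esub>" "sq_act R r (sq_P R y) x t = \<one>\<^bsub>Q\<^esub>"
    using assms ract by (simp_all add: act_eq_lact_ract lact_P1 lact_P2)
  show "sq_act R r s x (sq_P R y) = \<one>\<^bsub>Q\<^esub>"
    using assms by (simp add: act_eq_ract_lact ract_P lact_closed)
qed

text \<open>Additivity in each scalar and \<open>act_P\<close> make the value independent of the
  representatives.\<close>

lemma act_bar_cls:
  assumes "r \<in> carrier E" "s \<in> carrier E" "x \<in> carrier Q" "t \<in> carrier E"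
  shows "sq_act_bar R (cls r) (cls s) x (cls t) = sq_act R r s x t"
  unfolding sq_act_bar_def
proof (rule the_elem_eqI)
  show "sq_act R r s x t \<in> {sq_act R r' s' x t' | r' s' t'. r' \<in> cls r \<and> s' \<in> cls s \<and> t' \<in> cls t}"
    using assms cls_self by blast
  fix y
  assume "y \<in> {sq_act R r' s' x t' | r' s' t'. r' \<in> cls r \<and> s' \<in> cls s \<and> t' \<in> cls t}"
  then show "y = sq_act R r s x t"
    using assms by (auto simp: mem_cls_iff act_add1 act_add2 act_add4 act_P act_closed)
qed

end

section \<open>The associated graded algebra of a BHP-module\<close>

context bhp_module
begin

section \<open>The subgroup \<open>[M,M]\<close> and its centrality\<close>

abbreviation K :: "'m set"
  where "K \<equiv> bhp_commutator R M"

text \<open>Minimality of \<open>[M,M]\<close> as an induction principle. Stability of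
  \<open>L\<close> under brackets comes from the third premise, as \<open>L\<close> lies in
  \<open>M\<close>.\<close>

lemma bhp_commutator_least:
  assumes "subgroup L M"
    and "\<And>m r. \<lbrakk>m \<in> L; r \<in> carrier E\<rbrakk> \<Longrightarrow> bhp_act M m r \<in> L"
    and "\<And>m n x. \<lbrakk>m \<in> carrier M; n \<in> carrier M; x \<in> carrier Q\<rbrakk> \<Longrightarrow> bhp_br M m n x \<in> L"
  shows "K \<subseteq> L"
proof -
  have "bhp_stable R M L"
    unfolding bhp_stable_def E_def[symmetric] Q_def[symmetric]
    using assms by (simp add: subgroup.mem_carrier[OF assms(1)])
  then show ?thesis
    unfolding bhp_commutator_def Q_def[symmetric] using assms by blast
qed

lemma K_subgroup: "subgroup K M"
  unfolding bhp_commutator_def Q_def[symmetric]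
proof (rule M.subgroups_Inter)
  \<comment> \<open>\<open>subgroups_Inter\<close> requires a nonempty family; \<open>M\<close>
    itself is a member.\<close>
  have "bhp_stable R M (carrier M)"
    unfolding bhp_stable_def E_def[symmetric] Q_def[symmetric]
    by (simp add: bhp_act_closed bhp_br_closed)
  then show "{K. subgroup K M \<and> bhp_stable R M K \<and>
      (\<forall>m\<in>carrier M. \<forall>n\<in>carrier M. \<forall>x\<in>carrier Q. bhp_br M m n x \<in> K)} \<noteq> {}"
    using M.subgroup_self bhp_br_closed by blast
qed auto

lemma K_carrier [simp]: "k \<in> K \<Longrightarrow> k \<in> carrier M"
  by (rule subgroup.mem_carrier[OF K_subgroup])

lemma br_in_K: "\<lbrakk>m \<in> carrier M; n \<in> carrier M; x \<in> carrier Q\<rbrakk> \<Longrightarrow> bhp_br M m n x \<in> K"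
  unfolding bhp_commutator_def Q_def[symmetric] by blast

lemma act_in_K: "\<lbrakk>k \<in> K; r \<in> carrier E\<rbrakk> \<Longrightarrow> bhp_act M k r \<in> K"
  unfolding bhp_commutator_def bhp_stable_def E_def[symmetric] by blast

text \<open>Additivity in the first argument makes the left annihilator of the brackets a subgroup,
  to be tested against the minimality of \<open>K\<close>.\<close>

lemma br_eq_one_subgroup:
  "subgroup {k \<in> carrier M. \<forall>n\<in>carrier M. \<forall>x\<in>carrier Q. bhp_br M k n x = \<one>} M"
proof
  have one: "bhp_br M \<one> n x = \<one>" if "n \<in> carrier M" "x \<in> carrier Q" for n x
    using bhp_br_add1[of \<one> \<one> n x] that by (simp add: bhp_br_closed)
  then show "\<one> \<in> {k \<in> carrier M. \<forall>n\<in>carrier M. \<forall>x\<in>carrier Q. bhp_br M k n x = \<one>}"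
    by simp
  fix k
  assume k: "k \<in> {k \<in> carrier M. \<forall>n\<in>carrier M. \<forall>x\<in>carrier Q. bhp_br M k n x = \<one>}"
  show "inv k \<in> {k \<in> carrier M. \<forall>n\<in>carrier M. \<forall>x\<in>carrier Q. bhp_br M k n x = \<one>}"
    using k bhp_br_add1[of k "inv k"] by (auto simp: bhp_br_closed one)
qed (auto simp: bhp_br_add1)

lemma br_K_left:
  assumes "k \<in> K" "n \<in> carrier M" "x \<in> carrier Q"
  shows "bhp_br M k n x = \<one>"
proof -
  have "K \<subseteq> {k \<in> carrier M. \<forall>n\<in>carrier M. \<forall>x\<in>carrier Q. bhp_br M k n x = \<one>}" (is "_ \<subseteq> ?L")
  proof (rule bhp_commutator_least[OF br_eq_one_subgroup])
    fix m r
    assume m: "m \<in> ?L" and r: "r \<in> carrier E"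
    have "bhp_br M (bhp_act M m r) n x = \<one>" if "n \<in> carrier M" "x \<in> carrier Q" for n x
      \<comment> \<open>With s = t = 1 the law moves r from m onto x, and m annihilates every
        bracket.\<close>
      using bhp_br_act[of m n r "\<one>\<^bsub>E\<^esub>" x "\<one>\<^bsub>E\<^esub>"] m r that
      by (simp add: bhp_act_one bhp_act_closed bhp_br_closed act_closed)
    then show "bhp_act M m r \<in> ?L"
      using m r by (simp add: bhp_act_closed)
  qed (auto simp: bhp_br_closed bhp_br_br)
  then show ?thesis
    using assms by blast
qed

lemma T_closed: "x \<in> carrier Q \<Longrightarrow> sq_T R x \<in> carrier Q"
  using T_hom by (auto simp: hom_def)

lemma br_K_right: "\<lbrakk>k \<in> K; n \<in> carrier M; x \<in> carrier Q\<rbrakk> \<Longrightarrow> bhp_br M n k x = \<one>"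
  using bhp_br_T[of k n x] by (simp add: br_K_left T_closed)

text \<open>The scalar 2 acts on m + n by doubling and also through \<open>bhp_add_act\<close>. As
  in \<open>add_swap\<close>, the last n stays until the bracket is known to be central.\<close>

lemma mult_swap:
  assumes "m \<in> carrier M" "n \<in> carrier M"
  shows "n \<otimes> m \<otimes> n = m \<otimes> n \<otimes> n \<otimes> bhp_br M m n (sq_H R (sq_two R))" (is "_ = _ \<otimes> ?b")
proof -
  have b: "?b \<in> carrier M"
    using assms by (simp add: bhp_br_closed H_closed sq_two_closed)
  have two: "bhp_act M m (sq_two R) = m \<otimes> m" if "m \<in> carrier M" for m
    unfolding sq_two_def using that by (fold E_def) (simp add: bhp_act_add bhp_act_one)
  have "(m \<otimes> n) \<otimes> (m \<otimes> n) = (m \<otimes> m) \<otimes> (n \<otimes> n) \<otimes> ?b"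
    using assms bhp_add_act[OF assms sq_two_closed] by (simp add: two)
  then have "m \<otimes> (n \<otimes> m \<otimes> n) = m \<otimes> (m \<otimes> n \<otimes> n \<otimes> ?b)"
    using assms b by (simp add: M.m_assoc)
  then show ?thesis
    using assms b by simp
qed

text \<open>In \<open>mult_swap\<close> with first argument in \<open>K\<close> the bracket vanishes
  by \<open>br_K_left\<close>.\<close>

lemma K_central:
  assumes "k \<in> K" "m \<in> carrier M"
  shows "m \<otimes> k = k \<otimes> m"
proof -
  have "m \<otimes> k \<otimes> m = k \<otimes> m \<otimes> m"
    using mult_swap[of k m] assms by (simp add: br_K_left H_closed sq_two_closed)
  then show ?thesis
    using assms by simp
qed

lemma mult_commute_mod_K:
  assumes "m \<in> carrier M" "n \<in> carrier M"
  shows "\<exists>k\<in>K. n \<otimes> m = k \<otimes> (m \<otimes> n)"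
proof -
  define k where "k = bhp_br M m n (sq_H R (sq_two R))"
  have k: "k \<in> K"
    using assms by (simp add: k_def br_in_K H_closed sq_two_closed)
  have "n \<otimes> m \<otimes> n = k \<otimes> (m \<otimes> n) \<otimes> n"
    using mult_swap[OF assms] K_central[OF k, of "m \<otimes> n \<otimes> n"] assms k
    by (simp add: M.m_assoc flip: k_def)
  then show ?thesis
    using assms k by auto
qed

lemma K_normal: "K \<lhd> M"
  by (rule M.central_subgroup_normal[OF K_subgroup]) (simp add: K_central)

lemma mem_coset_iff: "m' \<in> K #> m \<longleftrightarrow> (\<exists>k\<in>K. m' = k \<otimes> m)"
  by (auto simp: r_coset_def)

lemma coset_self: "m \<in> carrier M \<Longrightarrow> m \<in> K #> m"
  by (rule M.rcos_self[OF _ K_subgroup])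

lemma coset_mult_K: "\<lbrakk>k \<in> K; m \<in> carrier M\<rbrakk> \<Longrightarrow> K #> (k \<otimes> m) = K #> m"
  by (rule M.r_coset_absorb[OF K_subgroup])

lemma coset_mult_K': "\<lbrakk>k \<in> K; m \<in> carrier M\<rbrakk> \<Longrightarrow> K #> (m \<otimes> k) = K #> m"
  by (simp add: K_central coset_mult_K)

text \<open>A change of m by k in \<open>K\<close> contributes k acted on by r', again in
  \<open>K\<close>, and no bracket defect. A change of r by P(x) contributes [m,m] x, also in
  \<open>K\<close>.\<close>

lemma coset_act:
  assumes "m \<in> carrier M" "r \<in> carrier E" "m' \<in> K #> m" "r' \<in> cls r"
  shows "K #> bhp_act M m' r' = K #> bhp_act M m r"
proof -
  obtain k x where k: "k \<in> K" "m' = k \<otimes> m" and x: "x \<in> carrier Q" "r' = sq_P R x \<oplus>\<^bsub>E\<^esub> r"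
    using assms by (auto simp: mem_coset_iff mem_cls_iff)
  have r': "r' \<in> carrier E"
    using x assms by simp
  have "bhp_act M m' r' = bhp_act M k r' \<otimes> bhp_act M m r'"
    using assms k r' by (simp add: bhp_add_act br_K_left bhp_act_closed H_closed)
  moreover have "bhp_act M m r' = bhp_br M m m x \<otimes> bhp_act M m r"
    using assms x by (simp add: bhp_act_add bhp_act_P)
  ultimately show ?thesis
    using assms k x r' by (simp add: coset_mult_K act_in_K br_in_K bhp_act_closed bhp_br_closed)
qed

section \<open>Operations of the graded algebra on representatives, and its axioms\<close>

lemma carrier_op_1: "carrier (op_1 (Gr_gamma R M)) = (\<lambda>m. K #> m) ` carrier M"
  by (auto simp: Gr_gamma_def Let_def FactGroup_def RCOSETS_def)

lemma mult_op_1: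
  "\<lbrakk>m \<in> carrier M; n \<in> carrier M\<rbrakk> \<Longrightarrow>
    (K #> m) \<otimes>\<^bsub>op_1 (Gr_gamma R M)\<^esub> (K #> n) = K #> (m \<otimes> n)"
  by (simp add: Gr_gamma_def Let_def FactGroup_def normal.rcos_sum[OF K_normal])

lemma op_2_simps:
  "carrier (op_2 (Gr_gamma R M)) = K"
  "a \<otimes>\<^bsub>op_2 (Gr_gamma R M)\<^esub> b = a \<otimes> b"
  "\<one>\<^bsub>op_2 (Gr_gamma R M)\<^esub> = \<one>"
  by (simp_all add: Gr_gamma_def Let_def)

lemma op_act1_cosets:
  assumes "m \<in> carrier M" "r \<in> carrier E"
  shows "op_act1 (Gr_gamma R M) (K #> m) (cls r) = K #> bhp_act M m r"
proof -
  have "the_elem {K #> bhp_act M m' r' | m' r'. m' \<in> K #> m \<and> r' \<in> cls r} = K #> bhp_act M m r"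
    by (rule the_elem_eqI) (use assms coset_self cls_self in blast, use assms coset_act in blast)
  then show ?thesis
    by (simp add: Gr_gamma_def Let_def)
qed

text \<open>A change of r by P(x) adds [k,k] x, which is zero for k in \<open>K\<close>; in degree 1
  such a term merely lies in \<open>K\<close>.\<close>

lemma op_act2_coset:
  assumes "k \<in> K" "r \<in> carrier E"
  shows "op_act2 (Gr_gamma R M) k (cls r) = bhp_act M k r"
proof -
  have "the_elem {bhp_act M k r' | r'. r' \<in> cls r} = bhp_act M k r"
  proof (rule the_elem_eqI)
    show "bhp_act M k r \<in> {bhp_act M k r' | r'. r' \<in> cls r}"
      using assms cls_self by blast
  qed (use assms in \<open>auto simp: mem_cls_iff bhp_act_add bhp_act_P br_K_left bhp_act_closed\<close>)
  then show ?thesis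
    by (simp add: Gr_gamma_def Let_def)
qed

text \<open>Biadditivity splits off brackets with an argument in \<open>K\<close>, and these
  vanish.\<close>

lemma op_br_cosets:
  assumes "m \<in> carrier M" "n \<in> carrier M" "x \<in> carrier Q"
  shows "op_br (Gr_gamma R M) (K #> m) (K #> n) x = bhp_br M m n x"
proof -
  have "the_elem {bhp_br M m' n' x | m' n'. m' \<in> K #> m \<and> n' \<in> K #> n} = bhp_br M m n x"
  proof (rule the_elem_eqI)
    show "bhp_br M m n x \<in> {bhp_br M m' n' x | m' n'. m' \<in> K #> m \<and> n' \<in> K #> n}"
      using assms coset_self by blast
  qed (use assms in \<open>auto simp: mem_coset_iff bhp_br_add1 bhp_br_add2 br_K_left br_K_right
      bhp_br_closed\<close>)
  then show ?thesis
    by (simp add: Gr_gamma_def Let_def)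
qed

lemmas Gr_gamma_simps = carrier_op_1 mult_op_1 op_2_simps op_act1_cosets op_act2_coset op_br_cosets

text \<open>The defect [m,n] H(r) of additivity in the module variable lies in \<open>K\<close>, so
  cosets absorb it.\<close>

lemma Gr_gamma_module1: "right_module (sq_bar R) (op_1 (Gr_gamma R M)) (op_act1 (Gr_gamma R M))"
proof (rule right_module.intro)
  show "ring (sq_bar R)"
    by (rule sq_bar_ring)
  show "comm_group (op_1 (Gr_gamma R M))"
    using normal.comm_group_FactGroup[OF K_normal] mult_commute_mod_K
    by (simp add: Gr_gamma_def Let_def)
qed (auto simp: Gr_gamma_simps sq_bar_simps bhp_act_closed bhp_add_act coset_mult_K' br_in_K
    H_closed bhp_act_add bhp_act_act bhp_act_one)

text \<open>In degree 2 the same defect is a bracket of elements of \<open>K\<close>, hence zero;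
  addition commutes because \<open>K\<close> is central.\<close>

lemma Gr_gamma_module2: "right_module (sq_bar R) (op_2 (Gr_gamma R M)) (op_act2 (Gr_gamma R M))"
proof (rule right_module.intro)
  show "ring (sq_bar R)"
    by (rule sq_bar_ring)
  show "comm_group (op_2 (Gr_gamma R M))"
  proof (rule comm_groupI)
    show "\<exists>y\<in>carrier (op_2 (Gr_gamma R M)).
        y \<otimes>\<^bsub>op_2 (Gr_gamma R M)\<^esub> x = \<one>\<^bsub>op_2 (Gr_gamma R M)\<^esub>"
      if "x \<in> carrier (op_2 (Gr_gamma R M))" for x
      using that subgroup.m_inv_closed[OF K_subgroup]
      by (auto simp: op_2_simps intro!: bexI[of _ "inv x"])
    show "x \<otimes>\<^bsub>op_2 (Gr_gamma R M)\<^esub> y = y \<otimes>\<^bsub>op_2 (Gr_gamma R M)\<^esub> x"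
      if "x \<in> carrier (op_2 (Gr_gamma R M))" "y \<in> carrier (op_2 (Gr_gamma R M))" for x y
      using that by (simp add: op_2_simps K_central)
  qed (auto simp: op_2_simps M.m_assoc
      intro: subgroup.m_closed[OF K_subgroup] subgroup.one_closed[OF K_subgroup])
qed (auto simp: op_2_simps op_act2_coset sq_bar_simps act_in_K bhp_add_act br_K_left H_closed
    bhp_act_closed bhp_act_add bhp_act_act bhp_act_one subgroup.m_closed[OF K_subgroup])

lemma Gr_gamma_op_algebra: "op_algebra R (Gr_gamma R M)"
  by (intro op_algebra.intro square_ring_axioms Gr_gamma_module1 Gr_gamma_module2;
      fold Q_def;
      auto simp: Gr_gamma_simps sq_bar_simps bhp_br_closed br_in_K bhp_br_add1 bhp_br_add2
        bhp_br_add3 bhp_br_T bhp_act_closed bhp_br_act act_bar_cls T_closed act_closed)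

end

section \<open>The morphism induced by a linear map\<close>

theorem proposition2p3p4:
  fixes R :: "('e, 'x) square_ring_data"
    and M :: "('m, 'e, 'x) bhp_data"
    and N :: "('n, 'e, 'x) bhp_data"
    and f :: "'m \<Rightarrow> 'n"
  assumes "square_ring R"
    and "bhp_module R M"
    and "bhp_module R N"
    and "bhp_linear R M N f"
  shows "op_algebra_hom R (Gr_gamma R M) (Gr_gamma R N) (Gr_gamma_map R M N f) \<and>
    (\<forall>m \<in> carrier M. fst (Gr_gamma_map R M N f) (bhp_commutator R M #>\<^bsub>M\<^esub> m) =
      bhp_commutator R N #>\<^bsub>N\<^esub> f m) \<and>
    (\<forall>a \<in> bhp_commutator R M. snd (Gr_gamma_map R M N f) a = f a)"
proof -
  interpret M: bhp_module R "sq_e R" "sq_ee R" M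
    by (rule assms) simp_all
  interpret N: bhp_module R "sq_e R" "sq_ee R" N
    by (rule assms) simp_all
  have f_hom: "f \<in> hom M N"
    and f_act: "\<And>m r. \<lbrakk>m \<in> carrier M; r \<in> carrier (sq_e R)\<rbrakk> \<Longrightarrow>
      f (bhp_act M m r) = bhp_act N (f m) r"
    and f_br: "\<And>m n x. \<lbrakk>m \<in> carrier M; n \<in> carrier M; x \<in> carrier (sq_ee R)\<rbrakk> \<Longrightarrow>
      f (bhp_br M m n x) = bhp_br N (f m) (f n) x"
    using assms(4) by (simp_all add: bhp_linear_def)
  interpret f: group_hom M N f
    by unfold_locales (rule f_hom)
  have "M.K \<subseteq> {m \<in> carrier M. f m \<in> N.K}"
  proof (rule M.bhp_commutator_least)
    show "subgroup {m \<in> carrier M. f m \<in> N.K} M"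
      by unfold_locales
        (auto intro: subgroup.m_closed[OF N.K_subgroup] subgroup.one_closed[OF N.K_subgroup]
          subgroup.m_inv_closed[OF N.K_subgroup])
  qed (auto simp: M.bhp_act_closed M.bhp_br_closed f_act f_br N.act_in_K N.br_in_K)
  then have f_K: "f k \<in> N.K" if "k \<in> M.K" for k
    using that by blast
  \<comment> \<open>A change of m by k in \<open>M.K\<close> multiplies f(m) by f(k), which
    \<open>f_K\<close> places in \<open>N.K\<close>.\<close>
  have map1: "fst (Gr_gamma_map R M N f) (M.K #>\<^bsub>M\<^esub> m) = N.K #>\<^bsub>N\<^esub> f m" if m: "m \<in> carrier M" for m
  proof -
    have "the_elem {N.K #>\<^bsub>N\<^esub> f m' | m'. m' \<in> M.K #>\<^bsub>M\<^esub> m} = N.K #>\<^bsub>N\<^esub> f m"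
    proof (rule the_elem_eqI)
      show "N.K #>\<^bsub>N\<^esub> f m \<in> {N.K #>\<^bsub>N\<^esub> f m' | m'. m' \<in> M.K #>\<^bsub>M\<^esub> m}"
        using m M.coset_self by blast
    qed (use m in \<open>auto simp: M.mem_coset_iff N.coset_mult_K f_K\<close>)
    then show ?thesis
      by (simp add: Gr_gamma_map_def)
  qed
  have map2: "snd (Gr_gamma_map R M N f) a = f a" if "a \<in> M.K" for a
    using that by (simp add: Gr_gamma_map_def)
  have "op_algebra_hom R (Gr_gamma R M) (Gr_gamma R N) (Gr_gamma_map R M N f)"
  proof (intro op_algebra_hom.intro op_algebra_hom_axioms.intro
      M.Gr_gamma_op_algebra N.Gr_gamma_op_algebra)
    show "fst (Gr_gamma_map R M N f) \<in> hom (op_1 (Gr_gamma R M)) (op_1 (Gr_gamma R N))"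
      by (rule homI) (auto simp: M.Gr_gamma_simps N.Gr_gamma_simps map1)
    show "snd (Gr_gamma_map R M N f) \<in> hom (op_2 (Gr_gamma R M)) (op_2 (Gr_gamma R N))"
      by (rule homI) (auto simp: M.Gr_gamma_simps N.Gr_gamma_simps map2 f_K
          subgroup.m_closed[OF M.K_subgroup])
  \<comment> \<open>On representatives, compatibility with the operations is \<open>f_act\<close>
    and \<open>f_br\<close>. \<open>M.act_in_K\<close> and \<open>M.br_in_K\<close> keep the degree
    2 arguments in \<open>M.K\<close>, where \<open>restrict\<close> agrees with
    \<open>f\<close>.\<close>
  qed (auto simp: M.Gr_gamma_simps N.Gr_gamma_simps M.sq_bar_simps map1 map2 f_K f_act f_br
      M.act_in_K M.br_in_K M.bhp_act_closed)
  then show ?thesis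
    using map1 map2 by blast
qed

end
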